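(* Let $T$ be a double-star of order $m$ and let $G$ be a finite simple $2$-connected graph with minimum degree $\delta(G)\geq m+2$. Then $G$ contains a subgraph $T'$ isomorphic to $T$ such that $G-V(T')$ is $2$-connected.
   Context: Graphs are finite, undirected, without loops or multiple edges. A tree is a connected graph without cycles; a double-star is a tree having exactly two vertices of degree greater than one. The order of a graph is its number of vertices. $G-V(T')$ denotes the subgraph of $G$ induced by $V(G)\setminus V(T')$. *)

theory Defs
  imports "Graph_Theory.Graph_Theory"
begin

text \<open>
  Finite simple graphs are rendered by the locale \<^locale>\<open>pair_graph\<close>: finite, loop-free, symmetric
  sets of ordered pairs, so an undirected edge $uv$ is the pair of arcs $(u,v)$ and $(v,u)$.
  Consequently \<^const>\<open>out_degree\<close> is the number of neighbours of a vertex.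
\<close>

definition min_degree :: "('a, 'b) pre_digraph \<Rightarrow> nat" where
  "min_degree G = Min (out_degree G ` verts G)"

text \<open>
  The library predicate \<^const>\<open>tree\<close> is unsuitable for symmetric digraphs: \<^const>\<open>pre_digraph.cycle\<close>
  admits the closed walk $u \to v \to u$ of length two. In a loop-free symmetric digraph without
  parallel arcs, the cycles of the undirected graph are exactly those of length at least three.
\<close>

definition undirected_tree :: "('a, 'b) pre_digraph \<Rightarrow> bool" where
  "undirected_tree G \<longleftrightarrow>
     connected G \<and> \<not> (\<exists>p. pre_digraph.cycle G p \<and> length p \<ge> 3)"

definition double_star :: "('a, 'b) pre_digraph \<Rightarrow> bool" where
  "double_star G \<longleftrightarrow>
     undirected_tree G \<and> card {v \<in> verts G. out_degree G v > 1} = 2"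

text \<open>
  The usual convention: a $k$-connected graph has more than $k$ vertices. In particular
  the complete graph on two vertices is not 2-connected.
\<close>

definition k_connected :: "nat \<Rightarrow> ('a, 'b) pre_digraph \<Rightarrow> bool" where
  "k_connected k G \<longleftrightarrow>
     card (verts G) > k \<and>
     (\<forall>X \<subseteq> verts G. card X < k \<longrightarrow> connected (G \<restriction> (verts G - X)))"

end

theory Submission
  imports Defs
begin

text \<open>
  Among all copies $T'$ of $T$ in $G$ and all 2-connected (or single-edge) $B \subseteq G - V(T')$,
  choose $|B|$ maximal, and suppose that $G - V(T')$ has a vertex outside $B$. Let $P$ be the
  interior of a shortest ear of $B$ in $G$; then $B \cup P$ is 2-connected, so it suffices to find a
  copy of $T$ avoiding it. A double-star of order $m$ embeds on every edge whose two ends have degree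
  at least $m - 1$.

  If $|P| \ge 2$, minimality gives every vertex outside $B$ at most three neighbours in $B \cup P$,
  so $G - B - P$ is nonempty of minimum degree at least $m - 1$. If $P = \{t\}$, then $t \in T'$ by
  maximality of $B$. Every $x$ outside $B \cup T'$ has at most one neighbour in $B$, hence a
  neighbour outside $B \cup T'$, and at least $m$ neighbours outside $B \cup P$.
\<close>

section \<open>Connected vertex sets and ears\<close>

text \<open>\<open>rtrancl_on S E\<close> keeps every vertex of a walk inside \<open>S\<close>, so
  this is connectivity of the induced subgraph; nonemptiness agrees with
  \<open>connected\<close>.\<close>

definition conn_on :: "'a rel \<Rightarrow> 'a set \<Rightarrow> bool" where
  "conn_on E S \<longleftrightarrow> S \<noteq> {} \<and> (\<forall>x\<in>S. \<forall>y\<in>S. (x, y) \<in> rtrancl_on S E)"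

lemma conn_on_singleton: "conn_on E {x}"
  by (auto simp: conn_on_def)

lemma conn_on_Un:
  assumes "sym E" "conn_on E A" "conn_on E B" "a \<in> A" "b \<in> B" "(a, b) \<in> E"
  shows "conn_on E (A \<union> B)"
proof -
  let ?R = "rtrancl_on (A \<union> B) E"
  have sym: "sym ?R" using assms(1) by (rule rtrancl_on_sym)
  have A: "(x, a) \<in> ?R" if "x \<in> A" for x
    using assms(2,4) that by (auto simp: conn_on_def intro: rtrancl_on_mono[of E E A])
  have B: "(b, x) \<in> ?R" if "x \<in> B" for x
    using assms(3,5) that by (auto simp: conn_on_def intro: rtrancl_on_mono[of E E B])
  have "(a, b) \<in> ?R"
    using assms(4-6) by (auto intro: rtrancl_on_into_rtrancl_on[OF rtrancl_on_refl])
  then have "(x, a) \<in> ?R" if "x \<in> A \<union> B" for x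
    using A B that sym by (meson UnE rtrancl_on_trans symE)
  then have "(x, y) \<in> ?R" if "x \<in> A \<union> B" "y \<in> A \<union> B" for x y
    using that sym by (meson rtrancl_on_trans symE)
  then show ?thesis using assms(4) by (auto simp: conn_on_def)
qed

lemma conn_on_path:
  assumes "sym E" "successively (\<lambda>x y. (x, y) \<in> E) xs" "xs \<noteq> []"
  shows "conn_on E (set xs)"
  using assms(2,3)
proof (induction xs)
  case (Cons x xs)
  show ?case
  proof (cases xs)
    case Nil
    then show ?thesis by (simp add: conn_on_singleton)
  next
    case (Cons y ys)
    then have "conn_on E ({x} \<union> set xs)"
      using Cons.IH Cons.prems by (intro conn_on_Un[OF assms(1), where a = x and b = y] conn_on_singleton) auto
    then show ?thesis by simp
  qed
qed simp

text \<open>Either end of the path may be the attached one, and the path may be empty: both occur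
  when a vertex is deleted from a block with an ear.\<close>

lemma conn_on_attach_path:
  assumes "sym E" "conn_on E A" "successively (\<lambda>x y. (x, y) \<in> E) xs"
    and "xs \<noteq> [] \<Longrightarrow> \<exists>a\<in>A. (a, hd xs) \<in> E \<or> (a, last xs) \<in> E"
  shows "conn_on E (A \<union> set xs)"
proof (cases "xs = []")
  case False
  then obtain a b where "a \<in> A" "b \<in> set xs" "(a, b) \<in> E"
    using assms(4) by (meson hd_in_set last_in_set)
  then show ?thesis
    using conn_on_Un[OF assms(1,2) conn_on_path[OF assms(1,3) False]] by blast
qed (use assms in auto)

lemma conn_on_crossing_edge:
  assumes "conn_on E S" "B \<subseteq> S" "B \<noteq> {}" "B \<noteq> S"
  obtains b u where "b \<in> B" "u \<in> S - B" "(b, u) \<in> E"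
proof -
  obtain x y where xy: "x \<in> B" "y \<in> S - B" using assms by auto
  then have "(x, y) \<in> rtrancl_on S E" using assms(1,2) by (auto simp: conn_on_def)
  \<comment> \<open>Invariant along the walk: it is still in \<open>B\<close>, or it has already
    used an edge leaving \<open>B\<close>.\<close>
  then have "y \<in> B \<or> (\<exists>b\<in>B. \<exists>u\<in>S - B. (b, u) \<in> E)"
    by (induction rule: rtrancl_on_induct) (use xy in auto)
  then show thesis using xy that by blast
qed

text \<open>Unlike 2-connectedness, this admits a single edge, so the extremal choice of the block below
  needs only an edge of $G - V(T')$ rather than a cycle.\<close>

definition biconn_on :: "'a rel \<Rightarrow> 'a set \<Rightarrow> bool" where
  "biconn_on E B \<longleftrightarrow> 2 \<le> card B \<and> conn_on E B \<and> (\<forall>x\<in>B. conn_on E (B - {x}))"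

lemma biconn_on_edge:
  assumes "sym E" "(x, y) \<in> E" "x \<noteq> y"
  shows "biconn_on E {x, y}"
proof -
  have "conn_on E ({x} \<union> {y})"
    using assms by (intro conn_on_Un conn_on_singleton) auto
  moreover have "{x, y} - {x} = {y}" "{x, y} - {y} = {x}" using assms(3) by auto
  ultimately show ?thesis using assms(3) by (auto simp: biconn_on_def conn_on_singleton insert_commute)
qed

text \<open>The list holds the interior vertices only. Repetitions are allowed, so spliced walks are
  again ears; minimal length will exclude them.\<close>

definition ear :: "'a rel \<Rightarrow> 'a set \<Rightarrow> 'a set \<Rightarrow> 'a \<Rightarrow> 'a \<Rightarrow> 'a list \<Rightarrow> bool" where
  "ear E V B b c p \<longleftrightarrow> b \<in> B \<and> c \<in> B \<and> b \<noteq> c \<and> p \<noteq> [] \<and> set p \<subseteq> V - B \<and>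
     successively (\<lambda>x y. (x, y) \<in> E) p \<and> (b, hd p) \<in> E \<and> (c, last p) \<in> E"

text \<open>The competitors may have any two ends in \<open>B\<close>, since the shortcuts below
  move an end.\<close>

definition shortest_ear :: "'a rel \<Rightarrow> 'a set \<Rightarrow> 'a set \<Rightarrow> 'a \<Rightarrow> 'a \<Rightarrow> 'a list \<Rightarrow> bool" where
  "shortest_ear E V B b c p \<longleftrightarrow>
     ear E V B b c p \<and> (\<forall>b' c' q. ear E V B b' c' q \<longrightarrow> length p \<le> length q)"

text \<open>After deleting a vertex of \<open>B\<close>, the whole path still hangs on the rest of
  \<open>B\<close> by a surviving end. Deleting an interior vertex cuts the path into two pieces,
  each hanging on \<open>B\<close> by its own end.\<close>

lemma biconn_on_ear:
  assumes "sym E" "biconn_on E B" "ear E V B b c p" "distinct p"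
  shows "biconn_on E (B \<union> set p)"
proof -
  let ?s = "successively (\<lambda>x y. (x, y) \<in> E)"
  have B: "2 \<le> card B" "conn_on E B" "\<And>x. x \<in> B \<Longrightarrow> conn_on E (B - {x})"
    using assms(2) by (auto simp: biconn_on_def)
  have p: "b \<in> B" "c \<in> B" "b \<noteq> c" "p \<noteq> []" "set p \<inter> B = {}" "?s p" "(b, hd p) \<in> E" "(c, last p) \<in> E"
    using assms(3) by (auto simp: ear_def)
  have fin: "finite B" using B(1) by (metis card.infinite not_numeral_le_zero)
  have "card B \<le> card (B \<union> set p)" using fin by (intro card_mono) auto
  then have "2 \<le> card (B \<union> set p)" using B(1) by simp
  moreover have "conn_on E (B \<union> set p)"
    using p by (intro conn_on_attach_path[OF assms(1) B(2)]) auto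
  moreover have "conn_on E (B \<union> set p - {x})" if x: "x \<in> B \<union> set p" for x
  proof (cases "x \<in> B")
    case True
    then have "conn_on E ((B - {x}) \<union> set p)"
      using p by (intro conn_on_attach_path[OF assms(1) B(3)]) auto
    moreover have "(B - {x}) \<union> set p = B \<union> set p - {x}" using True p(5) by auto
    ultimately show ?thesis by simp
  next
    case False
    then obtain qs rs where qr: "p = qs @ x # rs" using x by (meson UnE split_list)
    have s: "?s qs" "?s rs"
      using p(6) unfolding qr by (auto simp: successively_append_iff successively_Cons)
    have "conn_on E (B \<union> set qs)"
      using p(1,7) qr by (intro conn_on_attach_path[OF assms(1) B(2) s(1)]) auto
    then have "conn_on E (B \<union> set qs \<union> set rs)"
      using p(2,8) qr by (intro conn_on_attach_path[OF assms(1) _ s(2)]) auto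
    moreover have "B \<union> set qs \<union> set rs = B \<union> set p - {x}"
      using assms(4) False qr by auto
    ultimately show ?thesis by simp
  qed
  ultimately show ?thesis by (auto simp: biconn_on_def)
qed

lemma ear_rev:
  assumes "sym E" "ear E V B b c p"
  shows "ear E V B c b (rev p)"
proof -
  have "(\<lambda>x y. (y, x) \<in> E) = (\<lambda>x y. (x, y) \<in> E)"
    using assms(1) by (auto simp: fun_eq_iff dest: symD)
  moreover have "successively (\<lambda>x y. (x, y) \<in> E) p" using assms(2) by (simp add: ear_def)
  ultimately have "successively (\<lambda>x y. (y, x) \<in> E) p" by metis
  then show ?thesis using assms(2) by (auto simp: ear_def hd_rev last_rev)
qed

text \<open>Leave \<open>B\<close> along an edge from \<open>b\<close> to \<open>u\<close>, then
  walk from \<open>u\<close> back to \<open>B\<close> without using \<open>b\<close>. Stopping at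
  the first vertex of \<open>B\<close> gives an end different from \<open>b\<close>.\<close>

lemma ear_exists:
  assumes "sym E" "conn_on E V" "\<And>x. x \<in> V \<Longrightarrow> conn_on E (V - {x})"
    and "B \<subseteq> V" "B \<noteq> V" "2 \<le> card B"
  shows "\<exists>b c p. ear E V B b c p"
proof -
  have "B \<noteq> {}" using assms(6) by auto
  then obtain b u where bu: "b \<in> B" "u \<in> V - B" "(b, u) \<in> E"
    using conn_on_crossing_edge[OF assms(2,4) _ assms(5)] by metis
  have "B \<noteq> {b}" using assms(6) by auto
  then obtain c where c: "c \<in> B" "c \<noteq> b" using bu(1) by blast
  have "(u, c) \<in> rtrancl_on (V - {b}) E"
    using assms(3)[of b] assms(4) bu c by (auto simp: conn_on_def)
  \<comment> \<open>Induction from the far end of the walk: each vertex outside \<open>B\<close>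
    starts a path outside \<open>B\<close> to the first return \<open>d\<close>; avoiding
    \<open>b\<close> makes \<open>d\<close> differ from it.\<close>
  then have "u \<in> B \<or> (\<exists>p d. d \<in> B - {b} \<and> p \<noteq> [] \<and> hd p = u \<and> set p \<subseteq> V - B \<and>
      successively (\<lambda>x y. (x, y) \<in> E) p \<and> (last p, d) \<in> E)"
  proof (induction rule: converse_rtrancl_on_induct)
    case base
    then show ?case using c by simp
  next
    case (step x y)
    show ?case
    proof (cases "x \<in> B")
      case x: False
      show ?thesis
      proof (cases "y \<in> B")
        case True
        then show ?thesis
          using step x by (intro disjI2 exI[of _ "[x]"] exI[of _ y]) auto
      next
        case False
        then obtain p d where "d \<in> B - {b}" "p \<noteq> []" "hd p = y" "set p \<subseteq> V - B"
          "successively (\<lambda>x y. (x, y) \<in> E) p" "(last p, d) \<in> E"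
          using step by blast
        then show ?thesis
          using step x by (intro disjI2 exI[of _ "x # p"] exI[of _ d]) (auto simp: successively_Cons)
      qed
    qed simp
  qed
  then obtain p d where "d \<in> B - {b}" "p \<noteq> []" "hd p = u" "set p \<subseteq> V - B"
      "successively (\<lambda>x y. (x, y) \<in> E) p" "(last p, d) \<in> E"
    using bu(2) by blast
  then have "ear E V B b d p" using bu symD[OF assms(1)] by (auto simp: ear_def)
  then show ?thesis by blast
qed

section \<open>Shortest ears\<close>

lemma shortest_ear_exists:
  assumes "ear E V B b c p"
  obtains b' c' p' where "shortest_ear E V B b' c' p'"
proof -
  have "\<exists>q. (\<exists>b c. ear E V B b c q) \<and> (\<forall>q'. (\<exists>b c. ear E V B b c q') \<longrightarrow> length q \<le> length q')"
    using assms by (intro ex_has_least_nat[of _ p]) blast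
  then show thesis using that unfolding shortest_ear_def by blast
qed

lemma shortest_ear_rev:
  "sym E \<Longrightarrow> shortest_ear E V B b c p \<Longrightarrow> shortest_ear E V B c b (rev p)"
  by (auto simp: shortest_ear_def ear_rev)

section \<open>Rerouting an ear and comparing lengths\<close>

lemma successively_take_drop:
  assumes "successively P xs"
  shows "successively P (take i xs)" "successively P (drop i xs)"
  using assms append_take_drop_id[of i xs] successively_append_iff by metis+

text \<open>The stretch between positions \<open>i\<close> and \<open>j\<close> is replaced by
  \<open>ws\<close>, keeping both positions. Empty \<open>ws\<close> removes a repetition; a single
  vertex gives a detour.\<close>

lemma ear_splice:
  assumes "ear E V B b c p" "i < length p" "j < length p"
    and "set ws \<subseteq> V - B" "successively (\<lambda>x y. (x, y) \<in> E) (p ! i # ws @ [p ! j])"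
  shows "ear E V B b c (take (Suc i) p @ ws @ drop j p)"
proof -
  let ?s = "successively (\<lambda>x y. (x, y) \<in> E)"
  have p: "p \<noteq> []" "set p \<subseteq> V - B" "?s p"
    using assms(1) by (auto simp: ear_def)
  have t: "take (Suc i) p = take i p @ [p ! i]" "drop j p = p ! j # drop (Suc j) p"
    using assms(2,3) by (auto simp: take_Suc_conv_app_nth Cons_nth_drop_Suc)
  have "?s (take (Suc i) p @ ws @ drop j p)"
    using assms(5) successively_take_drop[OF p(3), of "Suc i"] successively_take_drop[OF p(3), of j]
    unfolding t by (cases ws) (auto simp: successively_append_iff successively_Cons hd_append)
  moreover have "hd (take (Suc i) p @ ws @ drop j p) = hd p"
    using p(1) by (simp add: hd_append)
  moreover have "last (take (Suc i) p @ ws @ drop j p) = last p"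
    using p(1) assms(3) by simp
  moreover have "set (take (Suc i) p @ ws @ drop j p) \<subseteq> V - B"
    using p(2) assms(4) set_take_subset[of "Suc i" p] set_drop_subset[of j p] by auto
  ultimately show ?thesis using assms(1) by (auto simp: ear_def)
qed

text \<open>The ear is left after position \<open>i\<close> through \<open>w\<close>, so the first
  end \<open>b\<close> stays and the new end \<open>d\<close> must differ from it.\<close>

lemma ear_prefix:
  assumes "ear E V B b c p" "i < length p" "w \<in> V - B" "(p ! i, w) \<in> E"
    and "d \<in> B" "d \<noteq> b" "(d, w) \<in> E"
  shows "ear E V B b d (take (Suc i) p @ [w])"
proof -
  let ?s = "successively (\<lambda>x y. (x, y) \<in> E)"
  have p: "p \<noteq> []" "set p \<subseteq> V - B" "?s p"
    using assms(1) by (auto simp: ear_def)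
  have "?s (take (Suc i) p @ [w])"
    using assms(2,4) successively_take_drop(1)[OF p(3), of "Suc i"]
    by (auto simp: take_Suc_conv_app_nth successively_append_iff)
  moreover have "set (take (Suc i) p @ [w]) \<subseteq> V - B"
    using p(2) assms(3) set_take_subset[of "Suc i" p] by auto
  ultimately show ?thesis using assms p(1) by (auto simp: ear_def hd_append)
qed

text \<open>The detour has \<open>i + 1\<close> vertices before \<open>w\<close> and
  \<open>length p - j\<close> after it; comparison with \<open>length p\<close> bounds
  \<open>j\<close>. The vertex \<open>w\<close> may itself lie on \<open>p\<close>.\<close>

lemma shortest_ear_detour:
  assumes "shortest_ear E V B b c p" "i < j" "j < length p" "w \<in> V - B"
    and "(p ! i, w) \<in> E" "(w, p ! j) \<in> E"
  shows "j \<le> i + 2"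
proof -
  have "ear E V B b c p" using assms(1) by (simp add: shortest_ear_def)
  then have "ear E V B b c (take (Suc i) p @ [w] @ drop j p)"
    using assms by (intro ear_splice) auto
  then have "length p \<le> length (take (Suc i) p @ [w] @ drop j p)"
    using assms(1) unfolding shortest_ear_def by blast
  then show ?thesis using assms(2,3) by simp
qed

lemma shortest_ear_shortcut:
  assumes "shortest_ear E V B b c p" "i < length p" "w \<in> V - B" "(p ! i, w) \<in> E"
    and "d \<in> B" "d \<noteq> b" "(d, w) \<in> E"
  shows "length p \<le> i + 2"
proof -
  have "ear E V B b d (take (Suc i) p @ [w])"
    using assms by (intro ear_prefix) (auto simp: shortest_ear_def)
  then have "length p \<le> length (take (Suc i) p @ [w])"
    using assms(1) unfolding shortest_ear_def by blast
  then show ?thesis using assms(2) by simp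
qed

text \<open>Cutting out the walk between two occurrences of a vertex leaves a shorter ear.\<close>

lemma shortest_ear_distinct:
  assumes "shortest_ear E V B b c p"
  shows "distinct p"
proof (rule ccontr)
  assume "\<not> distinct p"
  then obtain i j where ij: "i < j" "j < length p" "p ! i = p ! j"
    unfolding distinct_conv_nth by (metis linorder_neqE_nat)
  have e: "ear E V B b c p" using assms by (simp add: shortest_ear_def)
  have p: "p \<noteq> []" "set p \<subseteq> V - B" "successively (\<lambda>x y. (x, y) \<in> E) p"
    using e by (auto simp: ear_def)
  have "ear E V B b c (take i p @ drop j p)"
  proof (cases i)
    \<comment> \<open>No position precedes the first occurrence, so splicing does not apply; the
      tail from \<open>j\<close> starts at the same vertex as \<open>p\<close>.\<close>
    case 0
    have "hd (drop j p) = hd p" using ij 0 p(1) by (simp add: hd_drop_conv_nth hd_conv_nth)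
    moreover have "set (drop j p) \<subseteq> V - B" using p(2) set_drop_subset[of j p] by blast
    ultimately show ?thesis
      using 0 ij(2) e successively_take_drop(2)[OF p(3)] by (auto simp: ear_def)
  next
    case (Suc k)
    have "(p ! k, p ! i) \<in> E"
      using p(3) ij(1,2) Suc by (simp add: successively_conv_nth)
    then have "ear E V B b c (take (Suc k) p @ [] @ drop j p)"
      using ij Suc e by (intro ear_splice) auto
    then show ?thesis using Suc by simp
  qed
  then have "length p \<le> length (take i p @ drop j p)"
    using assms unfolding shortest_ear_def by blast
  then show False using ij by simp
qed

text \<open>Two neighbours of \<open>w\<close> in \<open>B\<close> would make \<open>[w]\<close> a
  shorter ear. By detours, the neighbours on \<open>p\<close> occupy at most three consecutive
  positions, and only two if \<open>w\<close> also has a neighbour in \<open>B\<close>.\<close>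

lemma shortest_ear_card_neighbours:
  assumes "sym E" "finite B" "shortest_ear E V B b c p" "2 \<le> length p" "w \<in> V - B"
  shows "card (E `` {w} \<inter> (B \<union> set p)) \<le> 3"
proof -
  have e: "ear E V B b c p" using assms(3) by (simp add: shortest_ear_def)
  then have p: "b \<noteq> c" "set p \<inter> B = {}" by (auto simp: ear_def)
  have sym: "(y, x) \<in> E" if "(x, y) \<in> E" for x y using that assms(1) by (rule symD[rotated])
  define I where "I = {i. i < length p \<and> (w, p ! i) \<in> E}"
  define D where "D = E `` {w} \<inter> B"
  have "E `` {w} \<inter> set p = (!) p ` I"
    by (auto simp: I_def in_set_conv_nth)
  moreover have "finite I" by (simp add: I_def)
  ultimately have cI: "card (E `` {w} \<inter> set p) \<le> card I" by (simp add: card_image_le)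
  have D1: "x = y" if "x \<in> D" "y \<in> D" for x y
  proof (rule ccontr)
    assume "x \<noteq> y"
    then have "ear E V B x y [w]"
      using that assms(5) by (auto simp: ear_def D_def intro: sym)
    then have "length p \<le> length [w]" using assms(3) unfolding shortest_ear_def by blast
    then show False using assms(4) by simp
  qed
  have cD: "card D \<le> 1"
    using D1 assms(2) unfolding D_def by (auto simp: card_le_Suc0_iff_eq)
  have "card I + card D \<le> 3"
  proof (cases "I = {}")
    case False
    define k where "k = Min I"
    have k: "k \<in> I" "\<And>i. i \<in> I \<Longrightarrow> k \<le> i"
      using False \<open>finite I\<close> by (auto simp: k_def)
    have Isub: "I \<subseteq> {k, k + 1, k + 2}"
    proof
      fix i assume i: "i \<in> I"
      show "i \<in> {k, k + 1, k + 2}"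
      proof (cases "i = k")
        case False
        then have "k < i" using k(2)[OF i] by simp
        then have "i \<le> k + 2"
          using i k(1) assms(3,5) by (intro shortest_ear_detour) (auto simp: I_def intro: sym)
        then show ?thesis using \<open>k < i\<close> by auto
      qed simp
    qed
    show ?thesis
    proof (cases "D = {}")
      case True
      then show ?thesis using card_mono[OF _ Isub] by simp
    next
      case False
      then obtain d where d: "d \<in> B" "(d, w) \<in> E" by (auto simp: D_def intro: sym)
      have "\<exists>l. I \<subseteq> {l, l + 1}"
      \<comment> \<open>A shortcut cannot end at the end it starts from. For \<open>d = b\<close> it
        is applied to the reversed ear, leaving the first two positions; otherwise only the last two
        remain.\<close>
      proof (cases "d = b")
        case True
        have "i \<le> 1" if "i \<in> I" for i
        proof -
          have "length (rev p) \<le> (length p - Suc i) + 2"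
            using that d True p(1) assms(5) shortest_ear_rev[OF assms(1,3)]
            by (intro shortest_ear_shortcut[where w = w and d = d]) (auto simp: I_def rev_nth intro: sym)
          then show ?thesis using that by (auto simp: I_def)
        qed
        then have "I \<subseteq> {0, 0 + 1}" by force
        then show ?thesis by blast
      next
        case False
        have "length p \<le> i + 2" if "i \<in> I" for i
          using that d False assms(3,5)
          by (intro shortest_ear_shortcut[where w = w and d = d]) (auto simp: I_def intro: sym)
        then have "I \<subseteq> {length p - 2, (length p - 2) + 1}"
          using assms(4) by (force simp: I_def)
        then show ?thesis by blast
      qed
      then obtain l where "I \<subseteq> {l, l + 1}" by blast
      then have "card I \<le> 2" using card_mono[of "{l, l + 1}" I] by simp
      then show ?thesis using cD by simp
    qed
  qed (use cD in simp)
  moreover have "card (E `` {w} \<inter> (B \<union> set p)) \<le> card D + card (E `` {w} \<inter> set p)"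
    unfolding D_def Int_Un_distrib by (rule card_Un_le)
  ultimately show ?thesis using cI by simp
qed

section \<open>The extremal argument\<close>

lemma card_le_Int_plus_Diff:
  assumes "finite N" "finite M" "N - S \<subseteq> M"
  shows "card N \<le> card (N \<inter> S) + card M"
proof -
  have "card N = card ((N \<inter> S) \<union> (N - S))" by (simp add: Int_Diff_Un)
  also have "\<dots> \<le> card (N \<inter> S) + card (N - S)" by (rule card_Un_le)
  finally show ?thesis using card_mono[OF assms(2,3)] by simp
qed

text \<open>Here \<open>C W\<close> stands for "\<open>W\<close> is the vertex set of a copy of the
  double-star"; the tree enters only through its order and the embedding property
  \<open>embed\<close>.\<close>

lemma removable_vertex_set:
  fixes C :: "'a set \<Rightarrow> bool"
  assumes fin: "finite V" and EV: "E \<subseteq> V \<times> V" and sym: "sym E" and irr: "irrefl E"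
    and conn: "conn_on E V" "\<And>x. x \<in> V \<Longrightarrow> conn_on E (V - {x})"
    and deg: "\<And>v. v \<in> V \<Longrightarrow> m + 2 \<le> card (E `` {v})"
    and m: "2 \<le> m"
    and C: "\<And>W. C W \<Longrightarrow> W \<subseteq> V \<and> card W = m"
    and embed: "\<And>S x y. S \<subseteq> V \<Longrightarrow> x \<in> S \<Longrightarrow> y \<in> S \<Longrightarrow> (x, y) \<in> E \<Longrightarrow>
      m \<le> Suc (card (E `` {x} \<inter> S)) \<Longrightarrow> m \<le> Suc (card (E `` {y} \<inter> S)) \<Longrightarrow> \<exists>W\<subseteq>S. C W"
  shows "\<exists>W. C W \<and> biconn_on E (V - W)"
proof -
  have NV: "E `` {v} \<subseteq> V" for v using EV by auto
  then have finN: "finite (E `` {v})" for v using fin by (rule finite_subset)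
  have embed': "\<exists>W\<subseteq>S. C W"
    if S: "S \<subseteq> V" "S \<noteq> {}" "\<And>x. x \<in> S \<Longrightarrow> m \<le> Suc (card (E `` {x} \<inter> S))" for S
  proof -
    obtain x where x: "x \<in> S" using S(2) by blast
    \<comment> \<open>As \<open>m\<close> is at least 2, degree \<open>m - 1\<close> inside
      \<open>S\<close> is positive and supplies the central edge.\<close>
    then have "card (E `` {x} \<inter> S) \<noteq> 0" using S(3)[of x] m by auto
    then obtain y where "y \<in> S" "(x, y) \<in> E" unfolding card_eq_0_iff by blast
    then show ?thesis using embed[of S x y] S x by blast
  qed
  have "V \<noteq> {}" using conn(1) by (simp add: conn_on_def)
  moreover have "E `` {v} \<inter> V = E `` {v}" for v using NV by blast
  ultimately obtain W0 where W0: "C W0"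
    using embed'[of V] deg by fastforce
  \<comment> \<open>The copy and the block vary together, so a later copy \<open>W'\<close> may
    replace \<open>W\<close> while the block grows.\<close>
  define Q where "Q k \<longleftrightarrow> (\<exists>W B. C W \<and> B \<subseteq> V - W \<and> biconn_on E B \<and> card B = k)" for k
  have "Q 2"
  proof -
    have W0V: "W0 \<subseteq> V" "card W0 = m" "finite W0"
      using C[OF W0] fin by (auto intro: finite_subset)
    obtain v where v: "v \<in> V" using \<open>V \<noteq> {}\<close> by blast
    have "card V > m" using deg[OF v] card_mono[OF fin NV[of v]] by simp
    then obtain x where x: "x \<in> V - W0" using W0V by (metis DiffI less_irrefl subsetI subset_antisym)
    \<comment> \<open>At most \<open>m\<close> of the \<open>m + 2\<close> neighbours of
      \<open>x\<close> lie in \<open>W0\<close>; another one gives an edge avoiding the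
      copy.\<close>
    have "card (E `` {x}) \<le> card (E `` {x} \<inter> (V - W0)) + card W0"
      using NV by (intro card_le_Int_plus_Diff[OF finN W0V(3)]) blast
    then have "card (E `` {x} \<inter> (V - W0)) \<noteq> 0" using deg[of x] x W0V(2) by simp
    then obtain y where y: "y \<in> V - W0" "(x, y) \<in> E" unfolding card_eq_0_iff by blast
    have "x \<noteq> y" using y irr by (auto simp: irrefl_def)
    then show ?thesis unfolding Q_def
      using W0 x y biconn_on_edge[OF sym y(2)] by (intro exI[of _ W0] exI[of _ "{x, y}"]) auto
  qed
  moreover have "k \<le> card V" if "Q k" for k
    using that fin unfolding Q_def by (metis Diff_subset card_mono subset_trans)
  ultimately obtain k where k: "Q k" "\<And>l. Q l \<Longrightarrow> l \<le> k"
    using Nat.ex_has_greatest_nat[of Q 2 "card V"] by blast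
  then obtain W B where WB: "C W" "B \<subseteq> V - W" "biconn_on E B" "card B = k"
    unfolding Q_def by blast
  have max: "P = {}" if "C W'" "P \<subseteq> V - B" "W' \<subseteq> V - B - P" "biconn_on E (B \<union> P)" for W' P
  proof -
    have "Q (card (B \<union> P))" unfolding Q_def
      using that WB(2) by (intro exI[of _ W'] exI[of _ "B \<union> P"]) auto
    then have "card (B \<union> P) \<le> card B" using k(2) WB(4) by blast
    moreover have "finite B" "finite P" using WB(2) that(2) fin by (auto intro: finite_subset)
    moreover have "B \<inter> P = {}" using that(2) by auto
    ultimately show ?thesis by (simp add: card_Un_disjoint)
  qed
  have W: "W \<subseteq> V" "card W = m" "finite W" using C[OF WB(1)] fin by (auto intro: finite_subset)
  have finB: "finite B" using WB(2) fin by (auto intro: finite_subset)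
  have "V - W - B = {}"
  proof (rule ccontr)
    assume H: "V - W - B \<noteq> {}"
    \<comment> \<open>The ear is sought in all of \<open>V\<close>, so it may run through
      \<open>W\<close>; then a new copy has to be found off \<open>B\<close> and the ear.\<close>
    have "\<exists>b c p. ear E V B b c p"
      using WB(2,3) H by (intro ear_exists sym conn) (auto simp: biconn_on_def)
    then obtain b c p where p: "shortest_ear E V B b c p"
      using shortest_ear_exists by metis
    then have e: "ear E V B b c p" by (simp add: shortest_ear_def)
    then have p': "p \<noteq> []" "set p \<subseteq> V - B" by (auto simp: ear_def)
    have bi: "biconn_on E (B \<union> set p)"
      using biconn_on_ear[OF sym WB(3) e shortest_ear_distinct[OF p]] .
    show False
    proof (cases "2 \<le> length p")
      case True
      define S where "S = V - B - set p"
      have le: "card (E `` {w}) \<le> card (E `` {w} \<inter> S) + 3" if "w \<in> V - B" for w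
      proof -
        have "card (E `` {w}) \<le> card (E `` {w} \<inter> S) + card (E `` {w} \<inter> (B \<union> set p))"
          using finN NV by (intro card_le_Int_plus_Diff) (auto simp: S_def)
        then show ?thesis
          using shortest_ear_card_neighbours[OF sym finB p True that] by simp
      qed
      \<comment> \<open>Otherwise a vertex outside \<open>B\<close> would have at most three
        neighbours, but \<open>m + 2\<close> is at least 4.\<close>
      have "S \<noteq> {}"
      proof
        assume "S = {}"
        moreover obtain w where "w \<in> V - B" using H by blast
        ultimately show False using le[of w] deg[of w] m by simp
      qed
      moreover have "m \<le> Suc (card (E `` {x} \<inter> S))" if "x \<in> S" for x
        using le[of x] deg[of x] that by (simp add: S_def)
      ultimately obtain W' where "W' \<subseteq> S" "C W'"
        using embed'[of S] unfolding S_def by blast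
      then show False using max[OF _ p'(2) _ bi] p'(1) unfolding S_def by simp
    next
      case False
      then obtain t where t: "p = [t]" using p'(1) by (cases p) (auto simp: Suc_le_eq)
      define S where "S = V - B - {t}"
      \<comment> \<open>Otherwise the old copy \<open>W\<close> already avoids the larger
        block.\<close>
      have tW: "t \<in> W"
        using max[OF WB(1) p'(2) _ bi] W(1) WB(2) p'(1) t by auto
      \<comment> \<open>Two neighbours in \<open>B\<close> would make \<open>x\<close> a one-vertex
        ear avoiding \<open>W\<close>, contradicting maximality; so at most one of the
        \<open>m + 2\<close> neighbours is lost.\<close>
      have H1: "m + 1 \<le> card (E `` {x} - B)" if x: "x \<in> V - W - B" for x
      proof -
        have "y = z" if "y \<in> E `` {x} \<inter> B" "z \<in> E `` {x} \<inter> B" for y z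
        proof (rule ccontr)
          assume "y \<noteq> z"
          then have "ear E V B y z [x]"
            using that x sym by (auto simp: ear_def dest: symD)
          then have "biconn_on E (B \<union> {x})" using biconn_on_ear[OF sym WB(3), of V y z "[x]"] by simp
          then show False using max[OF WB(1), of "{x}"] x W(1) WB(2) by auto
        qed
        then have "card (E `` {x} \<inter> B) \<le> 1" using finB by (auto simp: card_le_Suc0_iff_eq)
        moreover have "card (E `` {x}) \<le> card (E `` {x} \<inter> (- B)) + card (E `` {x} \<inter> B)"
          using finB by (intro card_le_Int_plus_Diff[OF finN]) auto
        ultimately show ?thesis using deg[of x] x by (simp add: Diff_eq)
      qed
      have H2: "m \<le> Suc (card (E `` {x} \<inter> S))" if x: "x \<in> V - W - B" for x
      proof -
        have "card (E `` {x} - B) \<le> card ((E `` {x} - B) \<inter> S) + card {t}"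
          using NV finN by (intro card_le_Int_plus_Diff) (auto simp: S_def)
        also have "(E `` {x} - B) \<inter> S = E `` {x} \<inter> S" by (auto simp: S_def)
        finally show ?thesis using H1[OF x] by simp
      qed
      obtain x where x: "x \<in> V - W - B" using H by blast
      \<comment> \<open>Of the \<open>m + 1\<close> neighbours outside \<open>B\<close>, at most
        \<open>m\<close> lie in \<open>W\<close>.\<close>
      have "card (E `` {x} - B) \<le> card ((E `` {x} - B) \<inter> (V - W - B)) + card W"
        using NV finN W(3) by (intro card_le_Int_plus_Diff) auto
      then have "card ((E `` {x} - B) \<inter> (V - W - B)) \<noteq> 0" using H1[OF x] W(2) by simp
      then obtain y where y: "y \<in> V - W - B" "(x, y) \<in> E" unfolding card_eq_0_iff by blast
      \<comment> \<open>Vertices of \<open>W\<close> in \<open>S\<close> have no degree bound here,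
        so the embedding uses one edge whose two ends avoid \<open>W\<close>; its leaves may reuse
        \<open>W - {t}\<close>.\<close>
      have "\<exists>W'\<subseteq>S. C W'"
        using x y tW by (intro embed[of S x y] H2) (auto simp: S_def)
      then show False using max[OF _ p'(2) _ bi] p'(1) t unfolding S_def by auto
    qed
  qed
  then have "V - W = B" using WB(2) by auto
  then show ?thesis using WB(1,3) by blast
qed

section \<open>Induced subgraphs and double-stars\<close>

text \<open>\<open>connected\<close> is defined through the symmetric closure, which adds no arcs
  when the arc set is symmetric.\<close>

lemma mk_symmetric_induce:
  assumes "sym (parcs G)"
  shows "mk_symmetric (with_proj G \<restriction> S) = \<lparr>pverts = S, parcs = parcs G \<inter> S \<times> S\<rparr>"
  using assms by (auto simp: mk_symmetric_def induce_subgraph_def dest: symD)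

lemma connected_induce_iff_conn_on:
  assumes "sym (parcs G)"
  shows "connected (with_proj G \<restriction> S) \<longleftrightarrow> conn_on (parcs G) S"
proof -
  have "rtrancl_on S (parcs G \<inter> S \<times> S) = rtrancl_on S (parcs G)"
  proof (intro equalityI subrelI)
    fix x y assume "(x, y) \<in> rtrancl_on S (parcs G)"
    then show "(x, y) \<in> rtrancl_on S (parcs G \<inter> S \<times> S)"
      by (induction rule: rtrancl_on_induct) (auto intro: rtrancl_on_into_rtrancl_on)
  qed (auto intro: rtrancl_on_mono[of _ "parcs G" S S])
  then show ?thesis
    by (simp add: connected_def strongly_connected_def mk_symmetric_induce[OF assms] conn_on_def reachable_def)
qed

lemma induce_induce:
  "T \<subseteq> S \<Longrightarrow> (with_proj G \<restriction> S) \<restriction> T = with_proj G \<restriction> T"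
  by (auto simp: induce_subgraph_def)

lemma card_less_2_cases:
  assumes "finite X" "card X < 2"
  obtains "X = {}" | x where "X = {x}"
  using assms by (metis One_nat_def card_0_eq card_1_singletonE less_2_cases)

text \<open>A deleted set of fewer than two vertices is empty or a singleton; finiteness of
  \<open>S\<close> excludes infinite sets, whose \<open>card\<close> is 0. The strict size bound
  separates a 2-connected set from a single edge.\<close>

lemma k_connected_2_induce_iff:
  assumes "sym (parcs G)" "finite S"
  shows "k_connected 2 (with_proj G \<restriction> S) \<longleftrightarrow> 2 < card S \<and> biconn_on (parcs G) S"
proof -
  have conn: "connected ((with_proj G \<restriction> S) \<restriction> (S - X)) \<longleftrightarrow> conn_on (parcs G) (S - X)" for X
    by (simp add: induce_induce connected_induce_iff_conn_on[OF assms(1)])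
  have "(\<forall>X\<subseteq>S. card X < 2 \<longrightarrow> conn_on (parcs G) (S - X)) \<longleftrightarrow>
      conn_on (parcs G) S \<and> (\<forall>x\<in>S. conn_on (parcs G) (S - {x}))" (is "?L \<longleftrightarrow> ?R")
  proof
    assume L: ?L
    show ?R
    proof
      show "conn_on (parcs G) S" using L[rule_format, of "{}"] by simp
      show "\<forall>x\<in>S. conn_on (parcs G) (S - {x})" using L by simp
    qed
  next
    assume R: ?R
    show ?L
    proof (intro allI impI)
      fix X assume "X \<subseteq> S" "card X < 2"
      then show "conn_on (parcs G) (S - X)"
        using R card_less_2_cases[of X] assms(2) by (metis Diff_empty finite_subset insert_subset)
    qed
  qed
  then show ?thesis
    by (auto simp: k_connected_def conn biconn_on_def)
qed

section \<open>Shape and greedy embedding of double-stars\<close>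

lemma out_degree_with_proj: "out_degree (with_proj G) v = card (parcs G `` {v})"
proof -
  have "out_arcs (with_proj G) v = Pair v ` (parcs G `` {v})"
    by (auto simp: out_arcs_def)
  then show ?thesis by (simp add: out_degree_def card_image inj_on_def)
qed

text \<open>Vertices other than the two centres have at most one neighbour, so by connectedness
  every edge meets a centre. The last clause bounds the arcs from above, which is the form an
  embedding needs.\<close>

lemma double_star_structure:
  assumes "pair_graph T" "double_star (with_proj T)"
  obtains u v A A' where "u \<noteq> v" "pverts T = {u, v} \<union> A \<union> A'" "A \<inter> A' = {}"
    "u \<notin> A \<union> A'" "v \<notin> A \<union> A'"
    "\<forall>(a, b)\<in>parcs T.
      {a, b} = {u, v} \<or> (\<exists>w\<in>A. {a, b} = {u, w}) \<or> (\<exists>w\<in>A'. {a, b} = {v, w})"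
proof -
  interpret T: pair_graph T by fact
  let ?E = "parcs T"
  have symE: "sym ?E" using T.pair_sym_arcs by (simp add: symmetric_def)
  have sym: "(b, a) \<in> ?E" if "(a, b) \<in> ?E" for a b using T.arcs_symmetric that .
  have finN: "finite (?E `` {a})" for a
    by (rule finite_subset[OF _ T.pair_finite_verts]) (auto dest: T.in_arcsD2)
  have "card {v \<in> pverts T. 1 < card (?E `` {v})} = 2"
    using assms(2) by (simp add: double_star_def out_degree_with_proj)
  then obtain u v where uv: "u \<noteq> v" "{v \<in> pverts T. 1 < card (?E `` {v})} = {u, v}"
    by (auto simp: card_2_iff)
  then have uvV: "u \<in> pverts T" "v \<in> pverts T" by auto
  have leaf: "b = c" if "a \<notin> {u, v}" "(a, b) \<in> ?E" "(a, c) \<in> ?E" for a b c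
  proof -
    have "a \<in> pverts T" using that(2) by (rule T.in_arcsD1)
    then have "card (?E `` {a}) \<le> Suc 0" using uv(2) that(1) by (metis (mono_tags, lifting) One_nat_def mem_Collect_eq not_le)
    then show ?thesis using finN that(2,3) by (auto simp: card_le_Suc0_iff_eq)
  qed
  have "with_proj T \<restriction> pverts T = with_proj T"
    by (auto simp: induce_subgraph_def with_proj_def dest: T.arc_fst_in_verts T.arc_snd_in_verts)
  then have conn: "conn_on ?E (pverts T)"
    using assms(2) connected_induce_iff_conn_on[OF symE, of "pverts T"]
    by (simp add: double_star_def undirected_tree_def)
  have no_leaf_edge: "a \<in> {u, v} \<or> b \<in> {u, v}" if ab: "(a, b) \<in> ?E" for a b
  proof (rule ccontr)
    assume *: "\<not> (a \<in> {u, v} \<or> b \<in> {u, v})"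
    have "{a, b} \<subseteq> pverts T" using ab by (auto dest: T.in_arcsD1 T.in_arcsD2)
    moreover have "{a, b} \<noteq> pverts T" using * uvV by auto
    \<comment> \<open>Connectedness forces an edge out of \<open>{a, b}\<close>, hence a second
      neighbour of a leaf.\<close>
    ultimately obtain x y where "x \<in> {a, b}" "y \<in> pverts T - {a, b}" "(x, y) \<in> ?E"
      using conn_on_crossing_edge[OF conn, of "{a, b}"] by blast
    then show False using leaf[of a b y] leaf[of b a y] * ab sym[OF ab] by blast
  qed
  define A where "A = {w \<in> pverts T - {u, v}. (u, w) \<in> ?E}"
  define A' where "A' = pverts T - {u, v} - A"
  have arcs: "{a, b} = {u, v} \<or> (\<exists>w\<in>A. {a, b} = {u, w}) \<or> (\<exists>w\<in>A'. {a, b} = {v, w})"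
    if ab: "(a, b) \<in> ?E" for a b
  proof -
    have ba: "(b, a) \<in> ?E" using sym[OF ab] .
    have V: "a \<in> pverts T" "b \<in> pverts T" using ab by (auto dest: T.in_arcsD1 T.in_arcsD2)
    have ne: "a \<noteq> b" using T.no_loops'[OF ab] .
    have half: "{a, b} = {u, v} \<or> (\<exists>w\<in>A. {a, b} = {u, w}) \<or> (\<exists>w\<in>A'. {a, b} = {v, w})"
      if "(a, b) \<in> ?E" "a \<in> {u, v}" "a \<noteq> b" "b \<in> pverts T" for a b
    proof (cases "b \<in> {u, v}")
      case False
      show ?thesis
      proof (cases "a = u")
        case True
        then have "b \<in> A" using that False by (simp add: A_def)
        then show ?thesis using True by blast
      next
        case au: False
        \<comment> \<open>Here \<open>a\<close> is \<open>v\<close>, and the leaf \<open>b\<close>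
          cannot also be adjacent to \<open>u\<close>.\<close>
        then have "(u, b) \<notin> ?E" using leaf[of b u a] False sym that(1) by blast
        then have "b \<in> A'" using False that by (simp add: A_def A'_def)
        then show ?thesis using au that(2) by blast
      qed
    qed (use that in auto)
    show ?thesis
      using no_leaf_edge[OF ab] half[OF ab] half[OF ba] ne V by (auto simp: insert_commute)
  qed
  show thesis
    using uv(1) uvV arcs by (intro that[of u v A A']) (auto simp: A_def A'_def)
qed

text \<open>The centres go to \<open>x\<close> and \<open>y\<close>, and leaves are placed greedily:
  first \<open>card A\<close> neighbours of \<open>x\<close> other than \<open>y\<close>, then
  \<open>card A'\<close> neighbours of \<open>y\<close> avoiding \<open>x\<close> and those already
  used. Since the order is \<open>card A + card A' + 2\<close>, the degree bounds suffice.\<close>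

lemma double_star_embed:
  assumes T: "pair_graph T" "double_star (with_proj T)"
    and E: "sym E" "irrefl E" and S: "finite S" "x \<in> S" "y \<in> S" "(x, y) \<in> E"
    and deg: "card (pverts T) \<le> Suc (card (E `` {x} \<inter> S))" "card (pverts T) \<le> Suc (card (E `` {y} \<inter> S))"
  obtains f where "inj_on f (pverts T)" "f ` pverts T \<subseteq> S"
    "\<forall>(a, b)\<in>parcs T. (f a, f b) \<in> E"
proof -
  obtain u v A A' where st: "u \<noteq> v" "pverts T = {u, v} \<union> A \<union> A'" "A \<inter> A' = {}"
    "u \<notin> A \<union> A'" "v \<notin> A \<union> A'"
    and arcs: "\<forall>(a, b)\<in>parcs T.
      {a, b} = {u, v} \<or> (\<exists>w\<in>A. {a, b} = {u, w}) \<or> (\<exists>w\<in>A'. {a, b} = {v, w})"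
    using double_star_structure[OF T] by blast
  interpret T: pair_graph T by fact
  have fin: "finite A" "finite A'" using T.pair_finite_verts st(2) by auto
  have cT: "card (pverts T) = card A + card A' + 2"
    using st fin by (simp add: card_Un_disjoint)
  have xy: "x \<noteq> y" using S(4) E(2) by (auto simp: irrefl_def)
  have "card (E `` {x} \<inter> S - {y}) \<ge> card A"
    using deg(1) cT by (auto simp: card_Diff_singleton_if)
  then obtain X where X: "X \<subseteq> E `` {x} \<inter> S - {y}" "card X = card A" "finite X"
    using S(1) by (meson finite_Diff finite_Int finite_subset obtain_subset_with_card_n)
  have "card (E `` {y} \<inter> S) \<le> card (E `` {y} \<inter> S - ({x} \<union> X)) + card ({x} \<union> X)"
    unfolding Diff_eq[of _ "{x} \<union> X"] using S(1) X(3) by (intro card_le_Int_plus_Diff) auto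
  moreover have "card ({x} \<union> X) \<le> Suc (card A)" using X(2,3) by (simp add: card_insert_if)
  ultimately have "card (E `` {y} \<inter> S - ({x} \<union> X)) \<ge> card A'" using deg(2) cT by simp
  then obtain Y where Y: "Y \<subseteq> E `` {y} \<inter> S - ({x} \<union> X)" "card Y = card A'" "finite Y"
    using S(1) by (meson finite_Diff finite_Int finite_subset obtain_subset_with_card_n)
  obtain g where g: "bij_betw g A X" using finite_same_card_bij[OF fin(1) X(3)] X(2) by metis
  obtain h where h: "bij_betw h A' Y" using finite_same_card_bij[OF fin(2) Y(3)] Y(2) by metis
  define f where "f w = (if w = u then x else if w = v then y else if w \<in> A then g w else h w)" for w
  have fuv: "f u = x" "f v = y" using st(1) by (auto simp: f_def)
  have fA: "f w = g w" if "w \<in> A" for w using that st by (auto simp: f_def)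
  have fA': "f w = h w" if "w \<in> A'" for w using that st by (auto simp: f_def)
  have nx: "x \<notin> X" "y \<notin> Y" using X(1) Y(1) E(2) by (auto simp: irrefl_def)
  have bA: "bij_betw f A X" using g fA bij_betw_cong[of A f g X] by blast
  have bA': "bij_betw f A' Y" using h fA' bij_betw_cong[of A' f h Y] by blast
  have "bij_betw f {u, v} {x, y}" using fuv st(1) xy by (auto simp: bij_betw_def)
  then have bij: "bij_betw f (pverts T) ({x, y} \<union> X \<union> Y)"
    unfolding st(2) using bA bA' nx X(1) Y(1) by (intro bij_betw_combine) auto
  show thesis
  proof (rule that[of f])
    show "inj_on f (pverts T)" using bij by (simp add: bij_betw_def)
    show "f ` pverts T \<subseteq> S" using bij S X(1) Y(1) by (auto simp: bij_betw_def)
  next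
    have "(x, f w) \<in> E" if "w \<in> A" for w
      using bij_betwE[OF bA] X(1) that by blast
    moreover have "(y, f w) \<in> E" if "w \<in> A'" for w
      using bij_betwE[OF bA'] Y(1) that by blast
    ultimately show "\<forall>(a, b)\<in>parcs T. (f a, f b) \<in> E"
      using arcs S(4) fuv symD[OF E(1)] by (fastforce simp: doubleton_eq_iff)
  qed
qed

section \<open>Copies of a graph under an injective vertex map\<close>

lemma digraph_iso_map_image:
  assumes "pair_graph T" "inj_on f (pverts T)"
  shows "digraph_iso (with_proj T) (with_proj \<lparr>pverts = f ` pverts T, parcs = map_prod f f ` parcs T\<rparr>)"
proof -
  interpret T: pair_graph T by fact
  let ?h = "\<lparr>iso_verts = f, iso_arcs = map_prod f f, iso_head = snd, iso_tail = fst\<rparr>"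
  have "parcs T \<subseteq> pverts T \<times> pverts T" by (auto dest: T.in_arcsD1 T.in_arcsD2)
  then have "inj_on (map_prod f f) (parcs T)"
    using map_prod_inj_on[OF assms(2,2)] inj_on_subset by blast
  then have "T.digraph_isomorphism ?h"
    using assms(2) T.wf_digraph by (auto simp: T.digraph_isomorphism_def)
  moreover have "with_proj \<lparr>pverts = f ` pverts T, parcs = map_prod f f ` parcs T\<rparr> = app_iso ?h (with_proj T)"
    by (simp add: app_iso_def with_proj_def)
  ultimately show ?thesis unfolding digraph_iso_def by blast
qed

lemma pair_graph_map_image:
  assumes "pair_graph T" "inj_on f (pverts T)"
  shows "pair_graph \<lparr>pverts = f ` pverts T, parcs = map_prod f f ` parcs T\<rparr>"
proof -
  interpret T: pair_graph T by fact
  have *: "a \<in> pverts T" "b \<in> pverts T" "a \<noteq> b" "(b, a) \<in> parcs T" if "(a, b) \<in> parcs T" for a b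
    using that T.in_arcsD1 T.in_arcsD2 T.no_loops' T.arcs_symmetric by auto
  then have ne: "f a \<noteq> f b" if "(a, b) \<in> parcs T" for a b
    using that inj_onD[OF assms(2)] by blast
  show ?thesis
  proof
    show "symmetric (with_proj \<lparr>pverts = f ` pverts T, parcs = map_prod f f ` parcs T\<rparr>)"
      using *(4) by (force simp: symmetric_def intro!: symI)
  qed (use *(1,2) ne T.pair_finite_verts T.pair_finite_arcs in auto)
qed

section \<open>Passing from vertex sets back to subgraphs\<close>

theorem theorem3p2:
  fixes T :: "'a pair_pre_digraph" and G :: "'b pair_pre_digraph" and m :: nat
  assumes "pair_graph T" and "double_star (with_proj T)" and "card (pverts T) = m"
    and "pair_graph G" and "k_connected 2 (with_proj G)"
    and "min_degree (with_proj G) \<ge> m + 2"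
  shows "\<exists>T' :: 'b pair_pre_digraph.
           pair_graph T' \<and>
           subgraph (with_proj T') (with_proj G) \<and>
           digraph_iso (with_proj T) (with_proj T') \<and>
           k_connected 2 (with_proj G \<restriction> (pverts G - pverts T'))"
proof -
  interpret T: pair_graph T by fact
  interpret G: pair_graph G by fact
  let ?V = "pverts G" and ?E = "parcs G"
  note fin = G.pair_finite_verts
  have EV: "?E \<subseteq> ?V \<times> ?V" by (auto dest: G.in_arcsD1 G.in_arcsD2)
  have sym: "sym ?E" using G.pair_sym_arcs by (simp add: symmetric_def)
  have irr: "irrefl ?E" by (auto simp: irrefl_def dest: G.no_loops')
  have "with_proj G \<restriction> ?V = with_proj G"
    using EV by (auto simp: induce_subgraph_def with_proj_def)
  then have bi: "biconn_on ?E ?V" "2 < card ?V"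
    using assms(5) k_connected_2_induce_iff[OF sym fin] by auto
  have deg: "m + 2 \<le> card (?E `` {v})" if "v \<in> ?V" for v
  proof -
    have "min_degree (with_proj G) \<le> out_degree (with_proj G) v"
      unfolding min_degree_def using fin that by (intro Min_le) auto
    then show ?thesis using assms(6) by (simp add: out_degree_with_proj)
  qed
  have "2 \<le> m"
  proof -
    obtain u v where "u \<noteq> v" "{u, v} \<subseteq> pverts T"
      by (rule double_star_structure[OF assms(1,2)]) auto
    then have "card {u, v} \<le> m"
      using card_mono[OF T.pair_finite_verts, of "{u, v}"] assms(3) by auto
    then show ?thesis using \<open>u \<noteq> v\<close> by simp
  qed
  define C where "C W \<longleftrightarrow> (\<exists>f. inj_on f (pverts T) \<and> f ` pverts T = W \<and> W \<subseteq> ?V \<and>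
    (\<forall>(a, b) \<in> parcs T. (f a, f b) \<in> ?E))" for W
  have "\<exists>W. C W \<and> biconn_on ?E (?V - W)"
  proof (rule removable_vertex_set[OF fin EV sym irr _ _ deg \<open>2 \<le> m\<close>])
    show "conn_on ?E ?V" "\<And>x. x \<in> ?V \<Longrightarrow> conn_on ?E (?V - {x})"
      using bi by (auto simp: biconn_on_def)
    show "W \<subseteq> ?V \<and> card W = m" if "C W" for W
      using that assms(3) by (auto simp: C_def card_image)
    show "\<exists>W\<subseteq>S. C W"
      if S: "S \<subseteq> ?V" "x \<in> S" "y \<in> S" "(x, y) \<in> ?E" "m \<le> Suc (card (?E `` {x} \<inter> S))"
        "m \<le> Suc (card (?E `` {y} \<inter> S))" for S x y
    proof -
      obtain f where f: "inj_on f (pverts T)" "f ` pverts T \<subseteq> S"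
        "\<forall>(a, b)\<in>parcs T. (f a, f b) \<in> ?E"
        using double_star_embed[OF assms(1,2) sym irr finite_subset[OF S(1) fin] S(2-4)] S(5,6) assms(3)
        by blast
      then have "C (f ` pverts T)" using S(1) by (auto simp: C_def)
      then show ?thesis using f(2) by blast
    qed
  qed
  then obtain f where f: "inj_on f (pverts T)" "f ` pverts T \<subseteq> ?V"
    "\<forall>(a, b)\<in>parcs T. (f a, f b) \<in> ?E" "biconn_on ?E (?V - f ` pverts T)"
    unfolding C_def by blast
  \<comment> \<open>Only the image arcs are kept: the subgraph induced on these vertices may have
    further edges.\<close>
  define T' where "T' = \<lparr>pverts = f ` pverts T, parcs = map_prod f f ` parcs T\<rparr>"
  have T': "pair_graph T'" unfolding T'_def using pair_graph_map_image[OF assms(1) f(1)] .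
  interpret T': pair_graph T' by fact
  have "subgraph (with_proj T') (with_proj G)"
    using f(2,3) T'.wf_digraph G.wf_digraph by (intro subgraphI) (auto simp: T'_def)
  moreover have "digraph_iso (with_proj T) (with_proj T')"
    unfolding T'_def using digraph_iso_map_image[OF assms(1) f(1)] .
  \<comment> \<open>\<open>biconn_on\<close> alone would allow a single edge; a vertex with its
    \<open>m + 2\<close> neighbours gives at least \<open>m + 3\<close> vertices, so three
    remain.\<close>
  moreover have "2 < card (?V - f ` pverts T)"
  proof -
    obtain v where v: "v \<in> ?V" using bi(2) by fastforce
    have "card (insert v (?E `` {v})) \<le> card ?V"
      using EV v by (intro card_mono fin) auto
    moreover have "v \<notin> ?E `` {v}" using irr by (auto simp: irrefl_def)
    moreover have "finite (?E `` {v})" using EV fin by (auto intro: finite_subset)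
    ultimately have "m + 3 \<le> card ?V" using deg[OF v] by simp
    moreover have "card (f ` pverts T) = m" using f(1) assms(3) by (simp add: card_image)
    ultimately show ?thesis using f(2) T.pair_finite_verts by (simp add: card_Diff_subset)
  qed
  then have "k_connected 2 (with_proj G \<restriction> (?V - pverts T'))"
    using k_connected_2_induce_iff[OF sym, of "?V - pverts T'"] fin f(4) by (simp add: T'_def)
  ultimately show ?thesis using T' by blast
qed

end
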